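(* Let $A,B\colon\mathbb{C}\to\mathbb{H}_{\mathbb{C}}$ be polynomial maps satisfying $A^s=B^s=1$, set $\Phi=ALB$ with $L=1+\mathrm{i}e_1$, and assume that $X=\operatorname{Re}\int\Phi\,\mathrm{d}z\colon\mathbb{C}\to\mathbb{R}^4$ is superminimal. Then, modulo the exact stabiliser freedom of $L$, the null curve $\Phi$ admits one of the two representations $$\Phi=A_0\,L\,B(z)\qquad\text{or}\qquad\Phi=A(z)\,L\,B_0,$$ where $A_0\in\operatorname{Sp}(1,\mathbb{C})$ or, respectively, $B_0\in\operatorname{Sp}(1,\mathbb{C})$ is constant. More precisely, with $\alpha=A^cA'=\alpha_1e_1+\alpha_2e_2+\alpha_3e_3$ and $\beta=B'B^c=\beta_1e_1+\beta_2e_2+\beta_3e_3$: if $\alpha_2+\mathrm{i}\alpha_3\equiv0$, then $A$ may be replaced, without changing $\Phi$, by a constant factor $A_0$; and if $\beta_2-\mathrm{i}\beta_3\equiv0$, then $B$ may be replaced, without changing $\Phi$, by a constant factor $B_0$.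
   Context: $\mathbb{H}_{\mathbb{C}}:=\mathbb{H}\otimes_{\mathbb{R}}\mathbb{C}$ is the algebra of complex quaternions: elements $q=q_0+q_1e_1+q_2e_2+q_3e_3$ with $q_j\in\mathbb{C}$, where the imaginary unit $\mathrm{i}\in\mathbb{C}$ commutes with $e_1,e_2,e_3$, and $e_1^2=e_2^2=e_3^2=-1$, $e_1e_2=e_3=-e_2e_1$, $e_2e_3=e_1=-e_3e_2$, $e_3e_1=e_2=-e_1e_3$. The conjugate is $q^c:=q_0-q_1e_1-q_2e_2-q_3e_3$ and the symmetrised norm is $q^s:=qq^c=q_0^2+q_1^2+q_2^2+q_3^2$. $\operatorname{Sp}(1,\mathbb{C}):=\{q\in\mathbb{H}_{\mathbb{C}}: q^s=1\}$. Prime denotes $\mathrm{d}/\mathrm{d}z$. A polynomial map is one whose four complex components are polynomials in $z$. $\mathbb{H}_{\mathbb{C}}$ is identified with $\mathbb{C}^4$ via $q\leftrightarrow(q_0,q_1,q_2,q_3)$; $\operatorname{Re}$ is the componentwise real part $\mathbb{C}^4\to\mathbb{R}^4$, and $\int\Phi\,\mathrm{d}z$ denotes a holomorphic primitive of $\Phi$ (up to an additive constant). The exact left and right stabilisers of $L$ are $\{U\in\operatorname{Sp}(1,\mathbb{C}):UL=L\}$ and $\{V\in\operatorname{Sp}(1,\mathbb{C}):LV=L\}$. "Modulo the exact stabiliser freedom" means up to replacing $A$ by $AU$ and $B$ by $VB$, with $U,V$ holomorphic maps into the exact left, respectively right, stabiliser of $L$; such replacements do not change $\Phi=ALB$. With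 $z=u+\mathrm{i}v$, an immersion $X$ into $\mathbb{R}^4$ is conformal if $|X_u|^2=|X_v|^2=:e^{2\omega}$ and $\langle X_u,X_v\rangle=0$; it is minimal if moreover $X_{uu}+X_{vv}=0$ (equivalently the mean curvature vector vanishes). With $(\cdot)^\perp$ the orthogonal projection to the normal plane, put $\xi=\tfrac12e^{-2\omega}(X_{uu}-X_{vv})^\perp$ and $\eta=e^{-2\omega}(X_{uv})^\perp$. The curvature ellipse at a point is the image of the unit tangent circle under $w\mapsto\mathrm{II}(w,w)$, with $\mathrm{II}$ the second fundamental form; it is $\{\mathbf H+\xi\cos2\theta+\eta\sin2\theta\}$, where $\mathbf H$ is the mean curvature vector, and is called a circle (possibly degenerate to a point) iff $\langle\xi,\eta\rangle=0$ and $|\xi|=|\eta|$. A conformal immersion is superminimal if it is minimal and its curvature ellipse is a circle at every point. *)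

theory Defs
  imports "HOL-Analysis.Analysis" "HOL-Computational_Algebra.Polynomial"
begin

section \<open>Complex quaternions\<close>

datatype cquat = CQuat (cq0: complex) (cq1: complex) (cq2: complex) (cq3: complex)

lemma cquat_eq_iff:
  "p = q \<longleftrightarrow> cq0 p = cq0 q \<and> cq1 p = cq1 q \<and> cq2 p = cq2 q \<and> cq3 p = cq3 q"
  by (cases p; cases q) simp

instantiation cquat :: ring_1
begin

definition zero_cquat :: cquat where "0 = CQuat 0 0 0 0"

definition one_cquat :: cquat where "1 = CQuat 1 0 0 0"

definition plus_cquat :: "cquat \<Rightarrow> cquat \<Rightarrow> cquat" where
  "p + q = CQuat (cq0 p + cq0 q) (cq1 p + cq1 q) (cq2 p + cq2 q) (cq3 p + cq3 q)"

definition uminus_cquat :: "cquat \<Rightarrow> cquat" where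
  "- p = CQuat (- cq0 p) (- cq1 p) (- cq2 p) (- cq3 p)"

definition minus_cquat :: "cquat \<Rightarrow> cquat \<Rightarrow> cquat" where
  "p - q = CQuat (cq0 p - cq0 q) (cq1 p - cq1 q) (cq2 p - cq2 q) (cq3 p - cq3 q)"

definition times_cquat :: "cquat \<Rightarrow> cquat \<Rightarrow> cquat" where
  "p * q = CQuat
     (cq0 p * cq0 q - cq1 p * cq1 q - cq2 p * cq2 q - cq3 p * cq3 q)
     (cq0 p * cq1 q + cq1 p * cq0 q + cq2 p * cq3 q - cq3 p * cq2 q)
     (cq0 p * cq2 q - cq1 p * cq3 q + cq2 p * cq0 q + cq3 p * cq1 q)
     (cq0 p * cq3 q + cq1 p * cq2 q - cq2 p * cq1 q + cq3 p * cq0 q)"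

instance
  by standard
    (simp_all add: zero_cquat_def one_cquat_def plus_cquat_def uminus_cquat_def
      minus_cquat_def times_cquat_def cquat_eq_iff algebra_simps)

end

definition cq_of_complex :: "complex \<Rightarrow> cquat" where "cq_of_complex c = CQuat c 0 0 0"

definition e1 :: cquat where "e1 = CQuat 0 1 0 0"
definition e2 :: cquat where "e2 = CQuat 0 0 1 0"
definition e3 :: cquat where "e3 = CQuat 0 0 0 1"

lemmas cquat_defs = zero_cquat_def one_cquat_def plus_cquat_def uminus_cquat_def
  minus_cquat_def times_cquat_def cq_of_complex_def e1_def e2_def e3_def

lemma cquat_basis_mult:
  "e1 * e1 = - 1" "e2 * e2 = - 1" "e3 * e3 = - 1"
  "e1 * e2 = e3" "e2 * e1 = - e3"
  "e2 * e3 = e1" "e3 * e2 = - e1"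
  "e3 * e1 = e2" "e1 * e3 = - e2"
  by (simp_all add: cquat_defs)

lemma cq_of_complex_commute: "cq_of_complex c * q = q * cq_of_complex c"
  by (simp add: cquat_defs mult.commute)

lemma cquat_expand:
  "q = cq_of_complex (cq0 q) + cq_of_complex (cq1 q) * e1
     + cq_of_complex (cq2 q) * e2 + cq_of_complex (cq3 q) * e3"
  by (simp add: cquat_defs cquat_eq_iff)

definition qconj :: "cquat \<Rightarrow> cquat" where
  "qconj q = CQuat (cq0 q) (- cq1 q) (- cq2 q) (- cq3 q)"

definition qsym :: "cquat \<Rightarrow> cquat" where
  "qsym q = q * qconj q"

lemma qsym_eq:
  "qsym q = cq_of_complex ((cq0 q)\<^sup>2 + (cq1 q)\<^sup>2 + (cq2 q)\<^sup>2 + (cq3 q)\<^sup>2)"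
  by (simp add: qsym_def qconj_def cquat_defs power2_eq_square algebra_simps)

definition Sp1C :: "cquat set" where
  "Sp1C = {q. qsym q = 1}"

definition nullL :: cquat where
  "nullL = 1 + cq_of_complex \<i> * e1"

definition left_stab :: "cquat \<Rightarrow> cquat set" where
  "left_stab M = {U \<in> Sp1C. U * M = M}"

definition right_stab :: "cquat \<Rightarrow> cquat set" where
  "right_stab M = {V \<in> Sp1C. M * V = M}"

section \<open>Maps from the complex plane to the complex quaternions\<close>

definition polynomial_map :: "(complex \<Rightarrow> cquat) \<Rightarrow> bool" where
  "polynomial_map f \<longleftrightarrow>
     (\<forall>c \<in> {cq0, cq1, cq2, cq3}. \<exists>p :: complex poly. \<forall>z. c (f z) = poly p z)"

definition holomorphic_map :: "(complex \<Rightarrow> cquat) \<Rightarrow> bool" where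
  "holomorphic_map f \<longleftrightarrow>
     (\<forall>c \<in> {cq0, cq1, cq2, cq3}. (\<lambda>z. c (f z)) holomorphic_on UNIV)"

definition cq_deriv :: "(complex \<Rightarrow> cquat) \<Rightarrow> complex \<Rightarrow> cquat" where
  "cq_deriv f z = CQuat (deriv (\<lambda>w. cq0 (f w)) z) (deriv (\<lambda>w. cq1 (f w)) z)
                        (deriv (\<lambda>w. cq2 (f w)) z) (deriv (\<lambda>w. cq3 (f w)) z)"

definition is_primitive :: "(complex \<Rightarrow> cquat) \<Rightarrow> (complex \<Rightarrow> cquat) \<Rightarrow> bool" where
  "is_primitive F f \<longleftrightarrow>
     (\<forall>c \<in> {cq0, cq1, cq2, cq3}. \<forall>z. ((\<lambda>w. c (F w)) has_field_derivative c (f z)) (at z))"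

definition left_replaceable :: "cquat \<Rightarrow> (complex \<Rightarrow> cquat) \<Rightarrow> (complex \<Rightarrow> cquat) \<Rightarrow> bool" where
  "left_replaceable M A A' \<longleftrightarrow>
     (\<exists>U. holomorphic_map U \<and> (\<forall>z. U z \<in> left_stab M) \<and> (\<forall>z. A' z = A z * U z))"

definition right_replaceable :: "cquat \<Rightarrow> (complex \<Rightarrow> cquat) \<Rightarrow> (complex \<Rightarrow> cquat) \<Rightarrow> bool" where
  "right_replaceable M B B' \<longleftrightarrow>
     (\<exists>V. holomorphic_map V \<and> (\<forall>z. V z \<in> right_stab M) \<and> (\<forall>z. B' z = V z * B z))"

section \<open>Surfaces in four-space\<close>

definition Re4 :: "cquat \<Rightarrow> real ^ 4" where
  "Re4 q = vector [Re (cq0 q), Re (cq1 q), Re (cq2 q), Re (cq3 q)]"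

lemma Re4_nth:
  "Re4 q $ 1 = Re (cq0 q)" "Re4 q $ 2 = Re (cq1 q)"
  "Re4 q $ 3 = Re (cq2 q)" "Re4 q $ 4 = Re (cq3 q)"
  by (simp_all add: Re4_def vector_def)

definition dir_deriv :: "complex \<Rightarrow> (complex \<Rightarrow> real ^ 4) \<Rightarrow> complex \<Rightarrow> real ^ 4" where
  "dir_deriv d X z = vector_derivative (\<lambda>t::real. X (z + t *\<^sub>R d)) (at 0)"

text \<open>With \<open>z = u + \<i> v\<close>, these are the partial derivatives in \<open>u\<close> and \<open>v\<close>.\<close>

abbreviation du :: "(complex \<Rightarrow> real ^ 4) \<Rightarrow> complex \<Rightarrow> real ^ 4" where
  "du \<equiv> dir_deriv 1"
abbreviation dv :: "(complex \<Rightarrow> real ^ 4) \<Rightarrow> complex \<Rightarrow> real ^ 4" where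
  "dv \<equiv> dir_deriv \<i>"

text \<open>Smooth: the iterated directional derivatives of every order are real differentiable.\<close>

definition smooth_surface :: "(complex \<Rightarrow> real ^ 4) \<Rightarrow> bool" where
  "smooth_surface X \<longleftrightarrow> (\<forall>ds z. foldr dir_deriv ds X differentiable (at z))"

definition immersion :: "(complex \<Rightarrow> real ^ 4) \<Rightarrow> bool" where
  "immersion X \<longleftrightarrow> smooth_surface X \<and> (\<forall>z. inj (frechet_derivative X (at z)))"

definition conformal_immersion :: "(complex \<Rightarrow> real ^ 4) \<Rightarrow> bool" where
  "conformal_immersion X \<longleftrightarrow> immersion X \<and>
     (\<forall>z. (norm (du X z))\<^sup>2 = (norm (dv X z))\<^sup>2 \<and> du X z \<bullet> dv X z = 0)"

definition minimal_immersion :: "(complex \<Rightarrow> real ^ 4) \<Rightarrow> bool" where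
  "minimal_immersion X \<longleftrightarrow> conformal_immersion X \<and>
     (\<forall>z. du (du X) z + dv (dv X) z = 0)"

definition tangent_plane :: "(complex \<Rightarrow> real ^ 4) \<Rightarrow> complex \<Rightarrow> (real ^ 4) set" where
  "tangent_plane X z = span {du X z, dv X z}"

definition normal_part :: "(complex \<Rightarrow> real ^ 4) \<Rightarrow> complex \<Rightarrow> real ^ 4 \<Rightarrow> real ^ 4" where
  "normal_part X z w =
     (THE n. n \<in> (tangent_plane X z)\<^sup>\<bottom> \<and> w - n \<in> tangent_plane X z)"

lemma normal_part_ex1:
  "\<exists>!n. n \<in> (tangent_plane X z)\<^sup>\<bottom> \<and> w - n \<in> tangent_plane X z"
proof -
  let ?T = "tangent_plane X z"
  have sub: "subspace ?T"
    by (simp add: tangent_plane_def)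
  obtain y n where y: "y \<in> span ?T" and n: "\<And>t. t \<in> span ?T \<Longrightarrow> orthogonal n t"
    and w: "w = y + n"
    using orthogonal_subspace_decomp_exists [of ?T w] by metis
  have sp: "span ?T = ?T"
    using sub by (simp add: span_eq_iff)
  show ?thesis
  proof (rule ex1I [of _ n])
    show "n \<in> ?T\<^sup>\<bottom> \<and> w - n \<in> ?T"
      using y n w sp by (auto simp: orthogonal_comp_def orthogonal_commute)
  next
    fix m assume m: "m \<in> ?T\<^sup>\<bottom> \<and> w - m \<in> ?T"
    have "(w - m) - y \<in> ?T"
      using m y sp subspace_diff [OF sub] by simp
    moreover have "(w - m) - y = n - m"
      using w by simp
    ultimately have t: "n - m \<in> ?T" by simp
    have "n \<bullet> (n - m) = 0"
      using n t sp unfolding orthogonal_def by blast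
    moreover have "(n - m) \<bullet> m = 0"
      using m t unfolding orthogonal_comp_def orthogonal_def by blast
    ultimately have "(n - m) \<bullet> (n - m) = 0"
      by (simp add: inner_diff_left inner_diff_right inner_commute)
    then show "m = n" by simp
  qed
qed

text \<open>For a conformal immersion, \<open>exp (2 * \<omega>) = (norm (du X z))\<^sup>2\<close>.\<close>

definition ellipse_xi :: "(complex \<Rightarrow> real ^ 4) \<Rightarrow> complex \<Rightarrow> real ^ 4" where
  "ellipse_xi X z =
     (1 / (2 * (norm (du X z))\<^sup>2)) *\<^sub>R normal_part X z (du (du X) z - dv (dv X) z)"

definition ellipse_eta :: "(complex \<Rightarrow> real ^ 4) \<Rightarrow> complex \<Rightarrow> real ^ 4" where
  "ellipse_eta X z = (1 / (norm (du X z))\<^sup>2) *\<^sub>R normal_part X z (dv (du X) z)"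

definition curvature_ellipse_circle :: "(complex \<Rightarrow> real ^ 4) \<Rightarrow> complex \<Rightarrow> bool" where
  "curvature_ellipse_circle X z \<longleftrightarrow>
     ellipse_xi X z \<bullet> ellipse_eta X z = 0 \<and> norm (ellipse_xi X z) = norm (ellipse_eta X z)"

definition superminimal :: "(complex \<Rightarrow> real ^ 4) \<Rightarrow> bool" where
  "superminimal X \<longleftrightarrow> minimal_immersion X \<and> (\<forall>z. curvature_ellipse_circle X z)"

end

theory Submission
  imports Defs
begin

text \<open>For the real part of a null curve, the curvature ellipse is a circle exactly where \<open>\<Phi>'\<close> is
  null for the complex bilinear form. Since \<open>\<Phi>' = A (\<alpha> L + L \<beta>) B\<close> and the form is multiplicative,
  it takes the value \<open>4 (\<alpha>\<^sub>2 + \<i> \<alpha>\<^sub>3) (\<beta>\<^sub>2 - \<i> \<beta>\<^sub>3)\<close> there, so one of these two polynomials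
  vanishes identically. If the first does, then \<open>(A L)' = -\<i> \<alpha>\<^sub>1 (A L)\<close>; as \<open>A\<close> and \<open>\<alpha>\<^sub>1\<close> are
  polynomial, comparing degrees shows that \<open>A L\<close> is constant, and \<open>A(z)\<close> and \<open>A(0)\<close> differ by the
  stabiliser element \<open>A(z)\<^sup>c A(0)\<close>. The other case is symmetric.\<close>
section \<open>Algebra of complex quaternions\<close>

lemma cquat_sel_simps [simp]:
  "cq0 0 = 0" "cq1 0 = 0" "cq2 0 = 0" "cq3 0 = 0"
  "cq0 1 = 1" "cq1 1 = 0" "cq2 1 = 0" "cq3 1 = 0"
  "cq0 (p + q) = cq0 p + cq0 q" "cq1 (p + q) = cq1 p + cq1 q"
  "cq2 (p + q) = cq2 p + cq2 q" "cq3 (p + q) = cq3 p + cq3 q"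
  "cq0 (p - q) = cq0 p - cq0 q" "cq1 (p - q) = cq1 p - cq1 q"
  "cq2 (p - q) = cq2 p - cq2 q" "cq3 (p - q) = cq3 p - cq3 q"
  "cq0 (cq_of_complex c) = c" "cq1 (cq_of_complex c) = 0"
  "cq2 (cq_of_complex c) = 0" "cq3 (cq_of_complex c) = 0"
  "cq0 (qconj q) = cq0 q" "cq1 (qconj q) = - cq1 q"
  "cq2 (qconj q) = - cq2 q" "cq3 (qconj q) = - cq3 q"
  "cq0 nullL = 1" "cq1 nullL = \<i>" "cq2 nullL = 0" "cq3 nullL = 0"
  by (simp_all add: cquat_defs qconj_def nullL_def)

lemma cquat_sel_times:
  "cq0 (p * q) = cq0 p * cq0 q - cq1 p * cq1 q - cq2 p * cq2 q - cq3 p * cq3 q"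
  "cq1 (p * q) = cq0 p * cq1 q + cq1 p * cq0 q + cq2 p * cq3 q - cq3 p * cq2 q"
  "cq2 (p * q) = cq0 p * cq2 q - cq1 p * cq3 q + cq2 p * cq0 q + cq3 p * cq1 q"
  "cq3 (p * q) = cq0 p * cq3 q + cq1 p * cq2 q - cq2 p * cq1 q + cq3 p * cq0 q"
  by (simp_all add: times_cquat_def)

lemma cq_of_complex_sel_times [simp]:
  "cq0 (cq_of_complex c * q) = c * cq0 q" "cq1 (cq_of_complex c * q) = c * cq1 q"
  "cq2 (cq_of_complex c * q) = c * cq2 q" "cq3 (cq_of_complex c * q) = c * cq3 q"
  by (simp_all add: cquat_sel_times)

lemma mult_cq_of_complex_left: "p * (cq_of_complex c * q) = cq_of_complex c * (p * q)"
  by (simp add: cq_of_complex_commute[of c p] flip: mult.assoc)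

text \<open>The complex bilinear, not Hermitian, extension of the Euclidean product, so nonzero
  vectors can be null; \<open>qdot q q\<close> is the scalar in \<open>qsym q\<close>.\<close>

definition qdot :: "cquat \<Rightarrow> cquat \<Rightarrow> complex" where
  "qdot p q = cq0 p * cq0 q + cq1 p * cq1 q + cq2 p * cq2 q + cq3 p * cq3 q"

lemma qsym_qdot: "qsym q = cq_of_complex (qdot q q)"
  by (simp add: qsym_eq qdot_def power2_eq_square)

lemma qsym_eq_1_iff: "qsym q = 1 \<longleftrightarrow> qdot q q = 1"
  by (auto simp: qsym_qdot cquat_eq_iff)

text \<open>Euler's four-square identity over the complex numbers.\<close>

lemma qdot_mult: "qdot (p * q) (p * q) = qdot p p * qdot q q"
  unfolding qdot_def cquat_sel_times by algebra

lemma qdot_nullL [simp]: "qdot nullL nullL = 0"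
  by (simp add: qdot_def)

lemma qconj_mult_self: "qconj q * q = cq_of_complex (qdot q q)"
  by (simp add: cquat_eq_iff qdot_def cquat_sel_times algebra_simps)

lemma mult_qconj_self: "q * qconj q = cq_of_complex (qdot q q)"
  by (simp add: cquat_eq_iff qdot_def cquat_sel_times algebra_simps)

lemma cq_of_complex_0 [simp]: "cq_of_complex 0 = 0"
  by (simp add: cquat_eq_iff)

lemma cq_of_complex_1 [simp]: "cq_of_complex 1 = 1"
  by (simp add: cquat_eq_iff)

lemma qdot_qconj [simp]: "qdot (qconj q) (qconj q) = qdot q q"
  by (simp add: qdot_def)

text \<open>Left multiplication by \<open>e1\<close> acts on \<open>nullL\<close> as -i, and
  \<open>e3 * nullL\<close> is i times \<open>e2 * nullL\<close>. If the second coefficient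
  vanishes, \<open>nullL\<close> is an eigenvector of left multiplication by
  \<open>a\<close>.\<close>

lemma pure_mult_nullL:
  assumes "cq0 a = 0"
  shows "a * nullL = cq_of_complex (- \<i> * cq1 a) * nullL + cq_of_complex (cq2 a + \<i> * cq3 a) * (e2 * nullL)"
  using assms by (simp add: cquat_eq_iff cquat_sel_times e2_def algebra_simps)

text \<open>Mirror image: \<open>e1\<close> still acts as -i, but \<open>nullL * e3\<close> is -i
  times \<open>nullL * e2\<close>, hence the opposite sign in the second coefficient.\<close>

lemma nullL_mult_pure:
  assumes "cq0 b = 0"
  shows "nullL * b = cq_of_complex (- \<i> * cq1 b) * nullL + cq_of_complex (cq2 b - \<i> * cq3 b) * (nullL * e2)"
  using assms by (simp add: cquat_eq_iff cquat_sel_times e2_def algebra_simps)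

text \<open>In the two expansions above, \<open>nullL\<close>, \<open>e2 * nullL\<close> and
  \<open>nullL * e2\<close> are null, and \<open>nullL\<close> is orthogonal to the other two. Only
  the pairing of \<open>e2 * nullL\<close> with \<open>nullL * e2\<close> survives; it equals 2 and
  occurs twice.\<close>

lemma qdot_pure_nullL:
  assumes "cq0 a = 0" "cq0 b = 0"
  shows "qdot (a * nullL + nullL * b) (a * nullL + nullL * b)
    = 4 * (cq2 a + \<i> * cq3 a) * (cq2 b - \<i> * cq3 b)"
  using assms by (simp add: qdot_def cquat_sel_times algebra_simps)

section \<open>Derivatives of quaternion-valued maps\<close>

definition has_cq_deriv :: "(complex \<Rightarrow> cquat) \<Rightarrow> cquat \<Rightarrow> complex \<Rightarrow> bool" where
  "has_cq_deriv f D z \<longleftrightarrow>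
     ((\<lambda>w. cq0 (f w)) has_field_derivative cq0 D) (at z) \<and>
     ((\<lambda>w. cq1 (f w)) has_field_derivative cq1 D) (at z) \<and>
     ((\<lambda>w. cq2 (f w)) has_field_derivative cq2 D) (at z) \<and>
     ((\<lambda>w. cq3 (f w)) has_field_derivative cq3 D) (at z)"

lemma has_cq_deriv_primitive: "is_primitive F f \<Longrightarrow> has_cq_deriv F (f z) z"
  by (simp add: is_primitive_def has_cq_deriv_def)

lemma has_cq_deriv_const: "has_cq_deriv (\<lambda>_. q) 0 z"
  by (simp add: has_cq_deriv_def)

lemma has_cq_deriv_mult:
  assumes "has_cq_deriv f D z" "has_cq_deriv g E z"
  shows "has_cq_deriv (\<lambda>w. f w * g w) (D * g z + f z * E) z"
  using assms unfolding has_cq_deriv_def cquat_sel_times cquat_sel_simps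
  by (auto intro!: derivative_eq_intros simp: algebra_simps)

lemma has_cq_deriv_qdot:
  assumes "has_cq_deriv f D z"
  shows "((\<lambda>w. qdot (f w) (f w)) has_field_derivative 2 * qdot (f z) D) (at z)"
  using assms unfolding has_cq_deriv_def qdot_def
  by (auto intro!: derivative_eq_intros simp: algebra_simps)

text \<open>Applied with \<open>c\<close> = 1 to the unit factors and with \<open>c\<close> = 0 to
  the null curve.\<close>

lemma qdot_deriv_eq_0:
  assumes "has_cq_deriv f D z" and "\<And>w. qdot (f w) (f w) = c"
  shows "qdot (f z) D = 0"
proof -
  have "((\<lambda>w. c) has_field_derivative 2 * qdot (f z) D) (at z)"
    using has_cq_deriv_qdot[OF assms(1)] assms(2) by simp
  then show ?thesis
    using DERIV_unique[OF _ DERIV_const] by force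
qed

lemma polynomial_map_has_cq_deriv:
  assumes "polynomial_map f"
  shows "has_cq_deriv f (cq_deriv f z) z"
proof -
  have "((\<lambda>w. c (f w)) has_field_derivative deriv (\<lambda>w. c (f w)) z) (at z)"
    if "c \<in> {cq0, cq1, cq2, cq3}" for c
  proof -
    obtain p where "\<And>w. c (f w) = poly p w"
      using assms \<open>c \<in> _\<close> unfolding polynomial_map_def by blast
    then show ?thesis
      by (simp add: DERIV_deriv_iff_field_differentiable field_differentiable_def)
        (use poly_DERIV in blast)
  qed
  then show ?thesis
    by (simp add: has_cq_deriv_def cq_deriv_def)
qed

section \<open>Polynomial functions and linear differential equations\<close>

definition poly_fun :: "(complex \<Rightarrow> complex) \<Rightarrow> bool" where
  "poly_fun f \<longleftrightarrow> (\<exists>p. \<forall>z. f z = poly p z)"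

lemma poly_fun_const: "poly_fun (\<lambda>_. c)"
  unfolding poly_fun_def by (rule exI[of _ "[:c:]"]) simp

lemma poly_fun_add: "poly_fun f \<Longrightarrow> poly_fun g \<Longrightarrow> poly_fun (\<lambda>z. f z + g z)"
  unfolding poly_fun_def by (auto simp flip: poly_add)

lemma poly_fun_diff: "poly_fun f \<Longrightarrow> poly_fun g \<Longrightarrow> poly_fun (\<lambda>z. f z - g z)"
  unfolding poly_fun_def by (auto simp flip: poly_diff)

lemma poly_fun_minus: "poly_fun f \<Longrightarrow> poly_fun (\<lambda>z. - f z)"
  unfolding poly_fun_def by (auto simp flip: poly_minus)

lemma poly_fun_mult: "poly_fun f \<Longrightarrow> poly_fun g \<Longrightarrow> poly_fun (\<lambda>z. f z * g z)"
  unfolding poly_fun_def by (auto simp flip: poly_mult)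

lemma poly_fun_holomorphic:
  assumes "poly_fun f" shows "f holomorphic_on S"
proof -
  obtain p where "f = poly p"
    using assms unfolding poly_fun_def by blast
  then show ?thesis
    by (auto simp: holomorphic_on_def field_differentiable_def intro!: exI DERIV_subset[OF poly_DERIV])
qed

lemma poly_fun_deriv:
  assumes "poly_fun f" shows "poly_fun (deriv f)"
proof -
  obtain p where "f = poly p"
    using assms unfolding poly_fun_def by blast
  then have "deriv f = poly (pderiv p)"
    by (auto intro: DERIV_imp_deriv poly_DERIV)
  then show ?thesis
    unfolding poly_fun_def by auto
qed

lemmas poly_fun_intros =
  poly_fun_const poly_fun_add poly_fun_diff poly_fun_minus poly_fun_mult poly_fun_deriv

lemma polynomial_map_poly_fun:
  "polynomial_map f \<longleftrightarrow> poly_fun (\<lambda>z. cq0 (f z)) \<and> poly_fun (\<lambda>z. cq1 (f z)) \<and>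
     poly_fun (\<lambda>z. cq2 (f z)) \<and> poly_fun (\<lambda>z. cq3 (f z))"
  by (simp add: polynomial_map_def poly_fun_def)

lemma polynomial_map_const: "polynomial_map (\<lambda>_. q)"
  by (simp add: polynomial_map_poly_fun poly_fun_const)

lemma polynomial_map_mult:
  "polynomial_map f \<Longrightarrow> polynomial_map g \<Longrightarrow> polynomial_map (\<lambda>z. f z * g z)"
  unfolding polynomial_map_poly_fun cquat_sel_times by (intro conjI poly_fun_intros) auto

lemma polynomial_map_qconj: "polynomial_map f \<Longrightarrow> polynomial_map (\<lambda>z. qconj (f z))"
  by (simp add: polynomial_map_poly_fun poly_fun_minus)

lemma polynomial_map_cq_deriv: "polynomial_map f \<Longrightarrow> polynomial_map (cq_deriv f)"
  unfolding polynomial_map_poly_fun cq_deriv_def by (simp add: poly_fun_deriv)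

lemma polynomial_map_holomorphic: "polynomial_map f \<Longrightarrow> holomorphic_map f"
  unfolding polynomial_map_poly_fun holomorphic_map_def by (simp add: poly_fun_holomorphic)

lemma poly_fun_mult_eq_0:
  assumes "poly_fun f" "poly_fun g" "\<And>z. f z * g z = 0"
  shows "(\<forall>z. f z = 0) \<or> (\<forall>z. g z = 0)"
proof -
  obtain p q where p: "\<And>z. f z = poly p z" and q: "\<And>z. g z = poly q z"
    using assms(1,2) unfolding poly_fun_def by blast
  have "poly (p * q) = poly 0"
    using assms(3) p q by auto
  then have "p = 0 \<or> q = 0"
    by (simp only: poly_eq_poly_eq_iff) simp
  then show ?thesis
    using p q by auto
qed

text \<open>In characteristic 0 the derivative of a nonconstant polynomial has smaller degree, while
  a nonzero multiple of \<open>p\<close> has degree at least that of \<open>p\<close>.\<close>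

lemma poly_dvd_pderiv_imp_0:
  fixes p :: "'a :: {idom, semiring_char_0} poly"
  assumes "p dvd pderiv p" shows "pderiv p = 0"
proof (rule ccontr)
  assume nz: "pderiv p \<noteq> 0"
  then have "degree p \<le> degree (pderiv p)"
    using assms by (rule dvd_imp_degree_le[rotated])
  moreover have "degree p \<noteq> 0"
    using nz by (simp add: pderiv_eq_0_iff)
  ultimately show False
    by (simp add: degree_pderiv)
qed

text \<open>The nonzero solutions are exponentials of primitives of \<open>h\<close>; comparing degrees shows that
  a polynomial one is constant.\<close>

lemma poly_fun_linear_ode_const:
  assumes f: "poly_fun f" and h: "poly_fun h"
    and ode: "\<And>z. (f has_field_derivative h z * f z) (at z)"
  shows "f z = f w"
proof -
  obtain p q where p: "\<And>z. f z = poly p z" and q: "\<And>z. h z = poly q z"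
    using f h unfolding poly_fun_def by blast
  have "poly (pderiv p) z = poly (q * p) z" for z
  proof -
    have "(poly p has_field_derivative h z * poly p z) (at z)"
      using ode[of z] unfolding ext[of f "poly p", OF p] .
    then show ?thesis
      using DERIV_unique[OF _ poly_DERIV[of p z]] p q by simp
  qed
  then have "pderiv p = q * p"
    by (auto simp flip: poly_eq_poly_eq_iff)
  then have "pderiv p = 0"
    using poly_dvd_pderiv_imp_0[of p] by simp
  then obtain c where "p = [:c:]"
    by (auto simp: pderiv_eq_0_iff elim: degree_eq_zeroE)
  then show ?thesis
    by (simp add: p)
qed

lemma polynomial_map_linear_ode_const:
  assumes f: "polynomial_map f" and h: "poly_fun h"
    and ode: "\<And>z. has_cq_deriv f (cq_of_complex (h z) * f z) z"
  shows "f z = f w"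
proof -
  have "c (f z) = c (f w)"
    if "poly_fun (\<lambda>z. c (f z))" "\<And>z. ((\<lambda>w. c (f w)) has_field_derivative h z * c (f z)) (at z)" for c
    using poly_fun_linear_ode_const[OF that(1) h that(2)] .
  then show ?thesis
    using f ode unfolding polynomial_map_poly_fun has_cq_deriv_def cquat_eq_iff by simp
qed

section \<open>Replacing a factor by a constant\<close>

text \<open>The scalar part is \<open>qdot\<close> of \<open>A z\<close> with its derivative, half
  the derivative of the constant \<open>qdot (A z) (A z)\<close>.\<close>

lemma qconj_deriv_pure:
  assumes "polynomial_map A" "\<And>z. qdot (A z) (A z) = 1"
  shows "cq0 (qconj (A z) * cq_deriv A z) = 0"
  using qdot_deriv_eq_0[OF polynomial_map_has_cq_deriv[OF assms(1)] assms(2)]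
  by (simp add: cquat_sel_times qdot_def)

lemma deriv_qconj_pure:
  assumes "polynomial_map B" "\<And>z. qdot (B z) (B z) = 1"
  shows "cq0 (cq_deriv B z * qconj (B z)) = 0"
  using qdot_deriv_eq_0[OF polynomial_map_has_cq_deriv[OF assms(1)] assms(2)]
  by (simp add: cquat_sel_times qdot_def mult.commute)

lemma left_factor_constant:
  assumes A: "polynomial_map A" and N: "\<And>z. qdot (A z) (A z) = 1"
    and \<alpha>: "\<And>z. \<alpha> z = qconj (A z) * cq_deriv A z"
    and 0: "\<And>z. cq2 (\<alpha> z) + \<i> * cq3 (\<alpha> z) = 0"
  shows "A z * nullL = A w * nullL"
proof (rule polynomial_map_linear_ode_const[of "\<lambda>z. A z * nullL"])
  show "polynomial_map (\<lambda>z. A z * nullL)"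
    by (intro polynomial_map_mult polynomial_map_const A)
  have "polynomial_map \<alpha>"
    unfolding \<alpha>[abs_def]
    by (intro polynomial_map_mult polynomial_map_qconj polynomial_map_cq_deriv A)
  then show "poly_fun (\<lambda>z. - \<i> * cq1 (\<alpha> z))"
    by (intro poly_fun_intros) (simp add: polynomial_map_poly_fun)
  fix z
  have pure: "cq0 (\<alpha> z) = 0"
    by (simp only: \<alpha> qconj_deriv_pure[OF A N])
  \<comment> \<open>Since \<open>A z * qconj (A z)\<close> is 1, the derivative of \<open>A\<close>
    is \<open>A z * \<alpha> z\<close>.\<close>
  have "cq_deriv A z * nullL = A z * (\<alpha> z * nullL)"
    by (simp add: \<alpha> mult.assoc[symmetric] mult_qconj_self N)
  also have "\<dots> = A z * (cq_of_complex (- \<i> * cq1 (\<alpha> z)) * nullL)"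
    by (simp only: pure_mult_nullL[OF pure] 0 cq_of_complex_0 mult_zero_left add_0_right)
  also have "\<dots> = cq_of_complex (- \<i> * cq1 (\<alpha> z)) * (A z * nullL)"
    by (rule mult_cq_of_complex_left)
  finally show "has_cq_deriv (\<lambda>z. A z * nullL) (cq_of_complex (- \<i> * cq1 (\<alpha> z)) * (A z * nullL)) z"
    using has_cq_deriv_mult[OF polynomial_map_has_cq_deriv[OF A, of z] has_cq_deriv_const[of nullL]]
    by simp
qed

lemma right_factor_constant:
  assumes B: "polynomial_map B" and N: "\<And>z. qdot (B z) (B z) = 1"
    and \<beta>: "\<And>z. \<beta> z = cq_deriv B z * qconj (B z)"
    and 0: "\<And>z. cq2 (\<beta> z) - \<i> * cq3 (\<beta> z) = 0"
  shows "nullL * B z = nullL * B w"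
proof (rule polynomial_map_linear_ode_const[of "\<lambda>z. nullL * B z"])
  show "polynomial_map (\<lambda>z. nullL * B z)"
    by (intro polynomial_map_mult polynomial_map_const B)
  have "polynomial_map \<beta>"
    unfolding \<beta>[abs_def]
    by (intro polynomial_map_mult polynomial_map_qconj polynomial_map_cq_deriv B)
  then show "poly_fun (\<lambda>z. - \<i> * cq1 (\<beta> z))"
    by (intro poly_fun_intros) (simp add: polynomial_map_poly_fun)
  fix z
  have pure: "cq0 (\<beta> z) = 0"
    by (simp only: \<beta> deriv_qconj_pure[OF B N])
  have "nullL * cq_deriv B z = nullL * \<beta> z * B z"
    by (simp add: \<beta> mult.assoc qconj_mult_self N)
  also have "\<dots> = cq_of_complex (- \<i> * cq1 (\<beta> z)) * nullL * B z"
    by (simp only: nullL_mult_pure[OF pure] 0 cq_of_complex_0 mult_zero_left add_0_right)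
  finally show "has_cq_deriv (\<lambda>z. nullL * B z) (cq_of_complex (- \<i> * cq1 (\<beta> z)) * (nullL * B z)) z"
    using has_cq_deriv_mult[OF has_cq_deriv_const[of nullL] polynomial_map_has_cq_deriv[OF B, of z]]
    by (simp add: mult.assoc)
qed

text \<open>The condition \<open>A0 = A z * U z\<close> forces
  \<open>U z = qconj (A z) * A0\<close>. It fixes \<open>M\<close> because \<open>A0 * M\<close> can
  be rewritten as \<open>A z * M\<close>, and it is holomorphic because conjugation keeps polynomial
  maps polynomial.\<close>

lemma left_replaceable_constant:
  assumes A: "polynomial_map A" and N: "\<And>z. qdot (A z) (A z) = 1"
    and const: "\<And>z. A z * M = A0 * M" and A0: "qdot A0 A0 = 1"
  shows "left_replaceable M A (\<lambda>_. A0)"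
  unfolding left_replaceable_def
proof (intro exI conjI allI)
  show "holomorphic_map (\<lambda>z. qconj (A z) * A0)"
    by (intro polynomial_map_holomorphic polynomial_map_mult polynomial_map_qconj
        polynomial_map_const A)
  fix z
  have "qconj (A z) * A0 * M = qconj (A z) * A z * M"
    by (simp add: mult.assoc const)
  then show "qconj (A z) * A0 \<in> left_stab M"
    by (simp add: left_stab_def Sp1C_def qsym_eq_1_iff qdot_mult N A0 qconj_mult_self)
  show "A0 = A z * (qconj (A z) * A0)"
    by (simp add: mult.assoc[symmetric] mult_qconj_self N)
qed

lemma right_replaceable_constant:
  assumes B: "polynomial_map B" and N: "\<And>z. qdot (B z) (B z) = 1"
    and const: "\<And>z. M * B z = M * B0" and B0: "qdot B0 B0 = 1"
  shows "right_replaceable M B (\<lambda>_. B0)"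
  unfolding right_replaceable_def
proof (intro exI conjI allI)
  show "holomorphic_map (\<lambda>z. B0 * qconj (B z))"
    by (intro polynomial_map_holomorphic polynomial_map_mult polynomial_map_qconj
        polynomial_map_const B)
  fix z
  have "M * (B0 * qconj (B z)) = M * (B z * qconj (B z))"
    by (simp add: mult.assoc[symmetric] const)
  then show "B0 * qconj (B z) \<in> right_stab M"
    by (simp add: right_stab_def Sp1C_def qsym_eq_1_iff qdot_mult N B0 mult_qconj_self)
  show "B0 = B0 * qconj (B z) * B z"
    by (simp add: mult.assoc qconj_mult_self N)
qed

section \<open>The curvature ellipse of the real part of a null curve\<close>

lemma inner_Re4:
  "Re4 p \<bullet> Re4 q = Re (cq0 p) * Re (cq0 q) + Re (cq1 p) * Re (cq1 q)
     + Re (cq2 p) * Re (cq2 q) + Re (cq3 p) * Re (cq3 q)"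
  by (simp add: inner_vec_def sum_4 Re4_nth)

text \<open>For \<open>q\<close> = \<Phi> the two vectors on the right are the partial derivatives
  of the surface, so every complex multiple of \<Phi> has tangential real part.\<close>

lemma Re4_scale:
  "Re4 (cq_of_complex c * q) = Re c *\<^sub>R Re4 q + Im c *\<^sub>R Re4 (cq_of_complex \<i> * q)"
  by (simp add: vec_eq_iff forall_4 Re4_nth)

text \<open>Conjugates the complex coefficients, unlike \<open>qconj\<close>;
  \<open>qdot p (qcnj q)\<close> is the Hermitian product on C^4.\<close>

definition qcnj :: "cquat \<Rightarrow> cquat" where
  "qcnj q = CQuat (cnj (cq0 q)) (cnj (cq1 q)) (cnj (cq2 q)) (cnj (cq3 q))"

text \<open>The product of two real parts is half the real part of the bilinear plus the Hermitian
  product, and scalars factor out of both.\<close>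

lemma inner_Re4_scale_eq_0:
  assumes "qdot p q = 0" "qdot p (qcnj q) = 0"
  shows "Re4 (cq_of_complex c * p) \<bullet> Re4 (cq_of_complex d * q) = 0"
proof -
  have "2 * (Re4 (cq_of_complex c * p) \<bullet> Re4 (cq_of_complex d * q))
     = Re (c * d * qdot p q + c * cnj d * qdot p (qcnj q))"
    by (simp add: inner_Re4 qdot_def qcnj_def algebra_simps)
  then show ?thesis
    using assms by simp
qed

text \<open>Multiplying by i turns the real part into minus the imaginary part. Thus
  \<open>q\<close> is null exactly when its real part and that of i \<open>q\<close> are orthogonal
  and of equal length, which is the circle condition.\<close>

lemma qdot_self_eq:
  "qdot q q = Complex (Re4 q \<bullet> Re4 q - Re4 (cq_of_complex \<i> * q) \<bullet> Re4 (cq_of_complex \<i> * q))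
     (- 2 * (Re4 q \<bullet> Re4 (cq_of_complex \<i> * q)))"
  by (simp add: complex_eq_iff qdot_def inner_Re4 algebra_simps)

lemma qdot_qcnj_self_eq_0: "qdot q (qcnj q) = 0 \<longleftrightarrow> q = 0"
proof -
  have "qdot q (qcnj q) = of_real ((cmod (cq0 q))\<^sup>2 + (cmod (cq1 q))\<^sup>2 + (cmod (cq2 q))\<^sup>2 + (cmod (cq3 q))\<^sup>2)"
    by (simp add: qdot_def qcnj_def flip: complex_norm_square)
  then show ?thesis
    by (auto simp: cquat_eq_iff add_nonneg_eq_0_iff simp del: of_real_add)
qed

text \<open>A holomorphic map varies in direction \<open>d\<close> by \<open>d\<close> times its
  complex derivative; \<open>d\<close> = 1 and \<open>d\<close> = i give the partial
  derivatives.\<close>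

lemma dir_deriv_Re4:
  assumes "has_cq_deriv G D z"
  shows "dir_deriv d (\<lambda>w. Re4 (G w)) z = Re4 (cq_of_complex d * D)"
  unfolding dir_deriv_def
proof (rule vector_derivative_at)
  have *: "((\<lambda>t. Re (g (z + t *\<^sub>R d))) has_vector_derivative Re (d * g')) (at 0)"
    if "(g has_field_derivative g') (at z)" for g g'
  proof -
    have "((\<lambda>t. z + t *\<^sub>R d) has_vector_derivative d) (at 0)"
      by (auto intro!: derivative_eq_intros)
    then have "(g \<circ> (\<lambda>t. z + t *\<^sub>R d) has_vector_derivative d * g') (at 0)"
      by (rule field_vector_diff_chain_at) (use that in simp)
    then show ?thesis
      unfolding o_def by (rule bounded_linear.has_vector_derivative[OF bounded_linear_Re])
  qed
  show "((\<lambda>t. Re4 (G (z + t *\<^sub>R d))) has_vector_derivative Re4 (cq_of_complex d * D)) (at 0)"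
    using assms unfolding has_vector_derivative_def has_cq_deriv_def
    by (subst has_derivative_componentwise_within)
      (auto simp: Basis_vec_def forall_4 inner_axis Re4_nth
        dest!: *[unfolded has_vector_derivative_def])
qed

lemma normal_part_eqI:
  assumes "n \<bullet> du X z = 0" "n \<bullet> dv X z = 0" "w - n \<in> tangent_plane X z"
  shows "normal_part X z w = n"
proof -
  have "tangent_plane X z \<subseteq> {x. orthogonal n x}"
    unfolding tangent_plane_def
    by (rule span_minimal) (use assms(1,2) in \<open>auto simp: orthogonal_def subspace_hyperplane\<close>)
  then have "n \<in> (tangent_plane X z)\<^sup>\<bottom> \<and> w - n \<in> tangent_plane X z"
    using assms(3) by (auto simp: orthogonal_comp_def orthogonal_commute)
  then show ?thesis
    unfolding normal_part_def using normal_part_ex1 by (rule the1_equality[rotated])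
qed

text \<open>The tangential part of \<open>\<Phi>'\<close> is a complex multiple of \<open>\<Phi>\<close>, because its component along the
  conjugate of \<open>\<Phi>\<close> is \<open>qdot \<Phi> \<Phi>' = 0\<close>. Subtracting a multiple of the null vector \<open>\<Phi>\<close>
  does not change \<open>qdot \<Phi>' \<Phi>'\<close>.\<close>

lemma circle_imp_isotropic_deriv:
  assumes F: "\<And>z. has_cq_deriv F (\<Phi> z) z" and \<Phi>: "\<And>z. has_cq_deriv \<Phi> (D z) z"
    and null: "\<And>z. qdot (\<Phi> z) (\<Phi> z) = 0" and nz: "\<Phi> z \<noteq> 0"
    and circle: "curvature_ellipse_circle (\<lambda>z. Re4 (F z)) z"
  shows "qdot (D z) (D z) = 0"
proof -
  define X where "X = (\<lambda>z. Re4 (F z))"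
  have i\<Phi>: "has_cq_deriv (\<lambda>w. cq_of_complex \<i> * \<Phi> w) (cq_of_complex \<i> * D w) w" for w
    using has_cq_deriv_mult[OF has_cq_deriv_const[of "cq_of_complex \<i>"] \<Phi>[of w]] by simp
  have du: "du X = (\<lambda>w. Re4 (\<Phi> w))"
    using dir_deriv_Re4[OF F] by (auto simp: X_def)
  have dv: "dv X = (\<lambda>w. Re4 (cq_of_complex \<i> * \<Phi> w))"
    using dir_deriv_Re4[OF F] by (auto simp: X_def)
  have duu: "du (du X) z = Re4 (D z)" and dvu: "dv (du X) z = Re4 (cq_of_complex \<i> * D z)"
    using dir_deriv_Re4[OF \<Phi>] by (auto simp: du)
  have "dv (dv X) z = Re4 (cq_of_complex \<i> * (cq_of_complex \<i> * D z))"
    using dir_deriv_Re4[OF i\<Phi>] by (auto simp: dv)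
  \<comment> \<open>The square of i makes \<open>dv (dv X) z\<close> the negative of
    \<open>du (du X) z\<close>; the resulting 2 cancels the 2 in the denominator of
    \<open>ellipse_xi\<close>.\<close>
  then have dvv: "du (du X) z - dv (dv X) z = Re4 (cq_of_complex 2 * D z)"
    by (simp add: duu vec_eq_iff forall_4 Re4_nth)
  have orth: "qdot (\<Phi> z) (D z) = 0"
    using qdot_deriv_eq_0[OF \<Phi> null] .
  \<comment> \<open>The coefficient of the Hermitian projection of \<open>D z\<close> onto
    \<open>\<Phi> z\<close>, which makes \<open>E\<close> Hermitian-orthogonal to
    \<open>\<Phi> z\<close>.\<close>
  define a where "a = qdot (D z) (qcnj (\<Phi> z)) / qdot (\<Phi> z) (qcnj (\<Phi> z))"
  define E where "E = D z - cq_of_complex a * \<Phi> z"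
  have "qdot E (qcnj (\<Phi> z)) = qdot (D z) (qcnj (\<Phi> z)) - a * qdot (\<Phi> z) (qcnj (\<Phi> z))"
    by (simp add: E_def qdot_def algebra_simps)
  then have E1: "qdot E (qcnj (\<Phi> z)) = 0"
    using nz by (simp add: a_def qdot_qcnj_self_eq_0)
  have "qdot E (\<Phi> z) = qdot (\<Phi> z) (D z) - a * qdot (\<Phi> z) (\<Phi> z)"
    by (simp add: E_def qdot_def algebra_simps)
  then have E2: "qdot E (\<Phi> z) = 0"
    by (simp add: orth null)
  have "qdot E E = qdot (D z) (D z) - 2 * a * qdot (\<Phi> z) (D z) + a\<^sup>2 * qdot (\<Phi> z) (\<Phi> z)"
    by (simp add: E_def qdot_def algebra_simps power2_eq_square)
  then have E3: "qdot E E = qdot (D z) (D z)"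
    by (simp add: orth null)
  \<comment> \<open>Stated for all \<open>c\<close>: the value 2 serves \<open>ellipse_xi\<close>
    and the value i serves \<open>ellipse_eta\<close>.\<close>
  have normal: "normal_part X z (Re4 (cq_of_complex c * D z)) = Re4 (cq_of_complex c * E)" for c
  proof (rule normal_part_eqI)
    show "Re4 (cq_of_complex c * E) \<bullet> du X z = 0"
      using inner_Re4_scale_eq_0[OF E2 E1, of c 1] by (simp add: du)
    show "Re4 (cq_of_complex c * E) \<bullet> dv X z = 0"
      using inner_Re4_scale_eq_0[OF E2 E1] by (simp add: dv)
    have "Re4 (cq_of_complex c * D z) - Re4 (cq_of_complex c * E)
       = Re4 (cq_of_complex (c * a) * \<Phi> z)"
      by (simp add: E_def vec_eq_iff forall_4 Re4_nth algebra_simps)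
    also have "\<dots> = Re (c * a) *\<^sub>R du X z + Im (c * a) *\<^sub>R dv X z"
      by (subst Re4_scale) (simp add: du dv)
    also have "\<dots> \<in> tangent_plane X z"
      unfolding tangent_plane_def by (intro span_add span_scale span_base) auto
    finally show "Re4 (cq_of_complex c * D z) - Re4 (cq_of_complex c * E) \<in> tangent_plane X z" .
  qed
  define k where "k = 1 / (norm (du X z))\<^sup>2"
  \<comment> \<open>A null vector has real and imaginary parts of equal length, so a vanishing real
    part would force \<open>\<Phi> z\<close> = 0. This makes the scale \<open>k\<close> positive, so
    it can be cancelled.\<close>
  have "Re4 (\<Phi> z) \<noteq> 0"
  proof
    assume R: "Re4 (\<Phi> z) = 0"
    then have "Re4 (cq_of_complex \<i> * \<Phi> z) = 0"
      using null[of z] by (simp add: qdot_self_eq Complex_eq_0)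
    with R have "\<Phi> z = 0"
      by (auto simp: vec_eq_iff forall_4 Re4_nth cquat_eq_iff complex_eq_iff)
    with nz show False ..
  qed
  then have k: "k > 0"
    by (simp add: k_def du)
  have xi: "ellipse_xi X z = k *\<^sub>R Re4 E"
    unfolding ellipse_xi_def dvv normal k_def by (subst Re4_scale) simp
  have eta: "ellipse_eta X z = k *\<^sub>R Re4 (cq_of_complex \<i> * E)"
    unfolding ellipse_eta_def dvu normal k_def ..
  have "Re4 E \<bullet> Re4 (cq_of_complex \<i> * E) = 0" "norm (Re4 E) = norm (Re4 (cq_of_complex \<i> * E))"
    using circle k by (auto simp: curvature_ellipse_circle_def xi eta simp flip: X_def)
  then have "qdot E E = 0"
    by (simp add: qdot_self_eq norm_eq_sqrt_inner complex_eq_iff)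
  then show ?thesis
    by (simp add: E3)
qed

section \<open>Constancy of one factor for superminimal surfaces\<close>

theorem proposition5p4:
  fixes A B \<Phi> F \<alpha> \<beta> :: "complex \<Rightarrow> cquat"
    and X :: "complex \<Rightarrow> real ^ 4"
  assumes "polynomial_map A" and "polynomial_map B"
    and "\<forall>z. qsym (A z) = 1" and "\<forall>z. qsym (B z) = 1"
    and "\<forall>z. \<Phi> z = A z * nullL * B z"
    and "is_primitive F \<Phi>"
    and "\<forall>z. X z = Re4 (F z)"
    and "superminimal X"
    and "\<forall>z. \<alpha> z = qconj (A z) * cq_deriv A z"
    and "\<forall>z. \<beta> z = cq_deriv B z * qconj (B z)"
  shows
    "((\<exists>A0 \<in> Sp1C. left_replaceable nullL A (\<lambda>_. A0) \<and> (\<forall>z. \<Phi> z = A0 * nullL * B z)) \<or>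
      (\<exists>B0 \<in> Sp1C. right_replaceable nullL B (\<lambda>_. B0) \<and> (\<forall>z. \<Phi> z = A z * nullL * B0))) \<and>
     ((\<forall>z. cq2 (\<alpha> z) + \<i> * cq3 (\<alpha> z) = 0) \<longrightarrow>
      (\<exists>A0 \<in> Sp1C. left_replaceable nullL A (\<lambda>_. A0) \<and> (\<forall>z. \<Phi> z = A0 * nullL * B z))) \<and>
     ((\<forall>z. cq2 (\<beta> z) - \<i> * cq3 (\<beta> z) = 0) \<longrightarrow>
      (\<exists>B0 \<in> Sp1C. right_replaceable nullL B (\<lambda>_. B0) \<and> (\<forall>z. \<Phi> z = A z * nullL * B0)))"
proof -
  note A = assms(1) and B = assms(2)
  have NA: "qdot (A z) (A z) = 1" and NB: "qdot (B z) (B z) = 1" for z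
    using assms(3,4) by (simp_all add: qsym_eq_1_iff)
  have \<Phi>: "\<Phi> = (\<lambda>z. A z * nullL * B z)" and X: "X = (\<lambda>z. Re4 (F z))"
    using assms(5,7) by auto
  have \<alpha>: "\<alpha> z = qconj (A z) * cq_deriv A z" and \<beta>: "\<beta> z = cq_deriv B z * qconj (B z)" for z
    using assms(9,10) by auto
  have left: "\<exists>A0 \<in> Sp1C. left_replaceable nullL A (\<lambda>_. A0) \<and> (\<forall>z. \<Phi> z = A0 * nullL * B z)"
    if "\<forall>z. cq2 (\<alpha> z) + \<i> * cq3 (\<alpha> z) = 0"
  proof (intro bexI conjI allI)
    have const: "A z * nullL = A 0 * nullL" for z
      by (rule left_factor_constant[OF A NA \<alpha>]) (use that in blast)
    show "left_replaceable nullL A (\<lambda>_. A 0)"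
      by (rule left_replaceable_constant[OF A NA const NA])
    show "\<Phi> z = A 0 * nullL * B z" for z
      by (simp only: \<Phi> const[of z])
    show "A 0 \<in> Sp1C"
      using assms(3) by (simp add: Sp1C_def)
  qed
  have right: "\<exists>B0 \<in> Sp1C. right_replaceable nullL B (\<lambda>_. B0) \<and> (\<forall>z. \<Phi> z = A z * nullL * B0)"
    if "\<forall>z. cq2 (\<beta> z) - \<i> * cq3 (\<beta> z) = 0"
  proof (intro bexI conjI allI)
    have const: "nullL * B z = nullL * B 0" for z
      by (rule right_factor_constant[OF B NB \<beta>]) (use that in blast)
    show "right_replaceable nullL B (\<lambda>_. B 0)"
      by (rule right_replaceable_constant[OF B NB const NB])
    show "\<Phi> z = A z * nullL * B 0" for z
      by (simp only: \<Phi> mult.assoc const[of z])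
    show "B 0 \<in> Sp1C"
      using assms(4) by (simp add: Sp1C_def)
  qed
  have "(cq2 (\<alpha> z) + \<i> * cq3 (\<alpha> z)) * (cq2 (\<beta> z) - \<i> * cq3 (\<beta> z)) = 0" for z
  proof -
    \<comment> \<open>The derivative of \<Phi> with \<open>A\<close> and \<open>B\<close> pulled
      out, so that multiplicativity of \<open>qdot\<close> leaves only the inner bracket.\<close>
    define D where "D w = A w * (\<alpha> w * nullL + nullL * \<beta> w) * B w" for w
    have \<Phi>D: "has_cq_deriv \<Phi> (D w) w" for w
    proof -
      have "A w * \<alpha> w = cq_deriv A w" "\<beta> w * B w = cq_deriv B w"
        by (simp_all add: \<alpha> \<beta> mult.assoc qconj_mult_self NB)
          (simp add: mult.assoc[symmetric] mult_qconj_self NA)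
      then have "cq_deriv A w * nullL * B w + A w * nullL * cq_deriv B w
          = (A w * \<alpha> w) * nullL * B w + A w * nullL * (\<beta> w * B w)"
        by (simp only:)
      also have "\<dots> = D w"
        by (simp only: D_def distrib_left distrib_right mult.assoc)
      finally show ?thesis
        using has_cq_deriv_mult[OF has_cq_deriv_mult[OF polynomial_map_has_cq_deriv[OF A, of w]
            has_cq_deriv_const[of nullL]] polynomial_map_has_cq_deriv[OF B, of w]]
        by (simp only: \<Phi> mult_zero_right add_0_right)
    qed
    have null: "qdot (\<Phi> w) (\<Phi> w) = 0" for w
      by (simp add: \<Phi> qdot_mult)
    \<comment> \<open>Undoing the invertible outer factors recovers \<open>nullL\<close>, so \<Phi>
      vanishes nowhere.\<close>
    have "qconj (A z) * \<Phi> z * qconj (B z) = (qconj (A z) * A z) * nullL * (B z * qconj (B z))"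
      by (simp add: \<Phi> mult.assoc)
    then have "qconj (A z) * \<Phi> z * qconj (B z) = nullL"
      by (simp add: qconj_mult_self mult_qconj_self NA NB)
    moreover have "nullL \<noteq> 0"
      by (simp add: cquat_eq_iff)
    ultimately have nz: "\<Phi> z \<noteq> 0"
      by auto
    have "curvature_ellipse_circle (\<lambda>z. Re4 (F z)) z"
      using assms(8) by (simp add: superminimal_def X)
    then have "qdot (D z) (D z) = 0"
      by (rule circle_imp_isotropic_deriv[OF has_cq_deriv_primitive[OF assms(6)] \<Phi>D null nz])
    moreover have "qdot (D z) (D z) = 4 * (cq2 (\<alpha> z) + \<i> * cq3 (\<alpha> z)) * (cq2 (\<beta> z) - \<i> * cq3 (\<beta> z))"
      using qdot_pure_nullL[of "\<alpha> z" "\<beta> z"] qconj_deriv_pure[OF A NA] deriv_qconj_pure[OF B NB]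
      by (simp add: D_def qdot_mult NA NB \<alpha> \<beta>)
    ultimately show ?thesis
      by (metis mult.assoc mult_eq_0_iff zero_neq_numeral)
  qed
  \<comment> \<open>Pointwise, the vanishing factor could depend on \<open>z\<close>; as both
    factors are polynomials and there are no zero divisors, one vanishes identically.\<close>
  moreover have "polynomial_map \<alpha>" "polynomial_map \<beta>"
    unfolding \<alpha>[abs_def] \<beta>[abs_def]
    by (intro polynomial_map_mult polynomial_map_qconj polynomial_map_cq_deriv A B)+
  then have "poly_fun (\<lambda>z. cq2 (\<alpha> z) + \<i> * cq3 (\<alpha> z))" "poly_fun (\<lambda>z. cq2 (\<beta> z) - \<i> * cq3 (\<beta> z))"
    by (auto simp: polynomial_map_poly_fun intro!: poly_fun_intros)
  ultimately have "(\<forall>z. cq2 (\<alpha> z) + \<i> * cq3 (\<alpha> z) = 0) \<or> (\<forall>z. cq2 (\<beta> z) - \<i> * cq3 (\<beta> z) = 0)"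
    by (intro poly_fun_mult_eq_0)
  then show ?thesis
    using left right by blast
qed

end
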